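(* Let $\mathcal M$ be an algebraic $IEL$-model and $\gamma:V\to M$ an assignment. Then there is a relational $IEL$-model $\mathcal K=(\mathcal F,g)$ such that for all $\varphi\in Fm_e$: $(\mathcal M,\gamma)\vDash\varphi$ iff $\mathcal K\vDash\varphi$.
   Context: $Fm_e$: formulas built from an infinite set $V$ of variables using $\bot,\wedge,\vee,\rightarrow$ and unary $K$. An algebraic $IEL^-$-model is a Heyting algebra $(M,f_\bot,f_\top,f_\vee,f_\wedge,f_\rightarrow)$ (order $\le$, $f_\neg(m):=f_\rightarrow(m,f_\bot)$) with a set $\mathit{BEL}\subseteq M$ and a unary operation $f_K$ such that for all $m,m'$: (i) $f_\top\in\mathit{BEL}$; (ii) $f_K(m)=f_\top\iff m\in\mathit{BEL}$; (iii) $m\le f_K(m)$; (iv) $f_K(f_\rightarrow(m,m'))\le f_\rightarrow(f_K(m),f_K(m'))$; (v) $f_\vee(m,m')=f_\top\Rightarrow(m=f_\top$ or $m'=f_\top)$. It is an algebraic $IEL$-model if additionally $f_K(m)\le f_\neg(f_\neg(m))$ for all $m$. An assignment $\gamma:V\to M$ extends homomorphically to $Fm_e$ ($\gamma(K\varphi)=f_K(\gamma(\varphi))$ etc.), and $(\mathcal M,\gamma)\vDash\varphi$ iff $\gamma(\varphi)=f_\top$. An $IEL$-frame is $(W,R,P,E)$: $W$ nonempty; $R$ a partial order on $W$ with least element $w_\bot$ in which every chain has an upper bound; $R(w):=\{w': wRw'\}$; $Max(W)$ the $R$-maximal elements; $P$ a set of $R$-upward closed subsets of $W$; $E:W\to\mathcal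 P(P)$ with each $E(w)$ a filter on $P$ (nonempty, closed under $\cap$, upward closed in $P$) and $wRw'\Rightarrow E(w)\subseteq E(w')$; $\varnothing,W\in P$ and $P$ closed under $\cap$, $\cup$, $A\supset B:=\{w:\forall w'\in R(w)(w'\in A\Rightarrow w'\in B)\}$, $KA:=\{w: A\in E(w)\}$; $Max(W)\cap R(w)\subseteq A$ for all $w$ and $A\in E(w)$; and (IntCo): $w\in A$ implies $A\in E(w)$ for all $w\in W$, $A\in P$. A relational $IEL$-model is $\mathcal K=(\mathcal F,g)$ with $g:V\to P$; satisfaction: $w\nvDash\bot$; $w\vDash x$ iff $w\in g(x)$; $\vee,\wedge$ pointwise; $w\vDash\varphi\rightarrow\psi$ iff for all $w'\in R(w)$, $w'\vDash\varphi\Rightarrow w'\vDash\psi$; $w\vDash K\varphi$ iff $\{w': w'\vDash\varphi\}\in E(w)$. $\mathcal K\vDash\varphi$ iff $w_\bot\vDash\varphi$.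
   Formalization: The Heyting algebra is assumed non-trivial (its bottom and top differ); for the one-element algebra the claim fails, since it satisfies falsum while no relational model does. *)

theory Defs
  imports Main
begin

section \<open>Formulas\<close>

text \<open>The set of propositional variables is the universe of the type \<open>'v\<close>; its infinitude is
  a hypothesis of the theorem.\<close>

datatype 'v fm =
    Var 'v
  | Falsum
  | Con "'v fm" "'v fm"
  | Dis "'v fm" "'v fm"
  | Imp "'v fm" "'v fm"
  | Know "'v fm"


section \<open>Algebraic semantics\<close>

record 'm heyting =
  univ :: "'m set"
  fBot :: 'm
  fTop :: 'm
  fOr :: "'m \<Rightarrow> 'm \<Rightarrow> 'm"
  fAnd :: "'m \<Rightarrow> 'm \<Rightarrow> 'm"
  fImp :: "'m \<Rightarrow> 'm \<Rightarrow> 'm"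

record 'm epistemic_algebra = "'m heyting" +
  BEL :: "'m set"
  fK :: "'m \<Rightarrow> 'm"

definition hle :: "('m, 'z) heyting_scheme \<Rightarrow> 'm \<Rightarrow> 'm \<Rightarrow> bool" where
  "hle M a b \<longleftrightarrow> fAnd M a b = a"

definition fNot :: "('m, 'z) heyting_scheme \<Rightarrow> 'm \<Rightarrow> 'm" where
  "fNot M a = fImp M a (fBot M)"

text \<open>A bounded lattice with relative pseudo-complements. The one-element algebra is not
  excluded here.\<close>

locale heyting_algebra =
  fixes M :: "('m, 'z) heyting_scheme"
  assumes bot_closed: "fBot M \<in> univ M"
    and top_closed: "fTop M \<in> univ M"
    and or_closed: "\<lbrakk>a \<in> univ M; b \<in> univ M\<rbrakk> \<Longrightarrow> fOr M a b \<in> univ M"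
    and and_closed: "\<lbrakk>a \<in> univ M; b \<in> univ M\<rbrakk> \<Longrightarrow> fAnd M a b \<in> univ M"
    and imp_closed: "\<lbrakk>a \<in> univ M; b \<in> univ M\<rbrakk> \<Longrightarrow> fImp M a b \<in> univ M"
    and or_comm: "\<lbrakk>a \<in> univ M; b \<in> univ M\<rbrakk> \<Longrightarrow> fOr M a b = fOr M b a"
    and and_comm: "\<lbrakk>a \<in> univ M; b \<in> univ M\<rbrakk> \<Longrightarrow> fAnd M a b = fAnd M b a"
    and or_assoc: "\<lbrakk>a \<in> univ M; b \<in> univ M; c \<in> univ M\<rbrakk>
      \<Longrightarrow> fOr M (fOr M a b) c = fOr M a (fOr M b c)"
    and and_assoc: "\<lbrakk>a \<in> univ M; b \<in> univ M; c \<in> univ M\<rbrakk>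
      \<Longrightarrow> fAnd M (fAnd M a b) c = fAnd M a (fAnd M b c)"
    and or_absorb: "\<lbrakk>a \<in> univ M; b \<in> univ M\<rbrakk> \<Longrightarrow> fOr M a (fAnd M a b) = a"
    and and_absorb: "\<lbrakk>a \<in> univ M; b \<in> univ M\<rbrakk> \<Longrightarrow> fAnd M a (fOr M a b) = a"
    and bot_least: "a \<in> univ M \<Longrightarrow> hle M (fBot M) a"
    and top_greatest: "a \<in> univ M \<Longrightarrow> hle M a (fTop M)"
    and residuation: "\<lbrakk>a \<in> univ M; b \<in> univ M; c \<in> univ M\<rbrakk>
      \<Longrightarrow> hle M c (fImp M a b) \<longleftrightarrow> hle M (fAnd M c a) b"

locale algebraic_IELm_model = heyting_algebra M
  for M :: "('m, 'z) epistemic_algebra_scheme" +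
  assumes BEL_subset: "BEL M \<subseteq> univ M"
    and K_closed: "a \<in> univ M \<Longrightarrow> fK M a \<in> univ M"
    and top_BEL: "fTop M \<in> BEL M"
    and K_top_iff: "a \<in> univ M \<Longrightarrow> fK M a = fTop M \<longleftrightarrow> a \<in> BEL M"
    and K_intro: "a \<in> univ M \<Longrightarrow> hle M a (fK M a)"
    and K_imp: "\<lbrakk>a \<in> univ M; b \<in> univ M\<rbrakk>
      \<Longrightarrow> hle M (fK M (fImp M a b)) (fImp M (fK M a) (fK M b))"
    and disjunction: "\<lbrakk>a \<in> univ M; b \<in> univ M; fOr M a b = fTop M\<rbrakk>
      \<Longrightarrow> a = fTop M \<or> b = fTop M"

locale algebraic_IEL_model = algebraic_IELm_model M
  for M :: "('m, 'z) epistemic_algebra_scheme" +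
  assumes K_reflection: "a \<in> univ M \<Longrightarrow> hle M (fK M a) (fNot M (fNot M a))"

primrec aeval :: "('m, 'z) epistemic_algebra_scheme \<Rightarrow> ('v \<Rightarrow> 'm) \<Rightarrow> 'v fm \<Rightarrow> 'm" where
  "aeval M \<gamma> (Var x) = \<gamma> x"
| "aeval M \<gamma> Falsum = fBot M"
| "aeval M \<gamma> (Con \<phi> \<psi>) = fAnd M (aeval M \<gamma> \<phi>) (aeval M \<gamma> \<psi>)"
| "aeval M \<gamma> (Dis \<phi> \<psi>) = fOr M (aeval M \<gamma> \<phi>) (aeval M \<gamma> \<psi>)"
| "aeval M \<gamma> (Imp \<phi> \<psi>) = fImp M (aeval M \<gamma> \<phi>) (aeval M \<gamma> \<psi>)"
| "aeval M \<gamma> (Know \<phi>) = fK M (aeval M \<gamma> \<phi>)"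

definition asat :: "('m, 'z) epistemic_algebra_scheme \<Rightarrow> ('v \<Rightarrow> 'm) \<Rightarrow> 'v fm \<Rightarrow> bool" where
  "asat M \<gamma> \<phi> \<longleftrightarrow> aeval M \<gamma> \<phi> = fTop M"


section \<open>Relational semantics\<close>

record 'w frame =
  worlds :: "'w set"
  acc :: "'w rel"
  props :: "'w set set"
  ev :: "'w \<Rightarrow> 'w set set"

definition up :: "('w, 'z) frame_scheme \<Rightarrow> 'w \<Rightarrow> 'w set" where
  "up F w = {w' \<in> worlds F. (w, w') \<in> acc F}"

definition max_worlds :: "('w, 'z) frame_scheme \<Rightarrow> 'w set" where
  "max_worlds F = {w \<in> worlds F. \<forall>w' \<in> worlds F. (w, w') \<in> acc F \<longrightarrow> w' = w}"

definition is_least_world :: "('w, 'z) frame_scheme \<Rightarrow> 'w \<Rightarrow> bool" where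
  "is_least_world F w \<longleftrightarrow> w \<in> worlds F \<and> (\<forall>w' \<in> worlds F. (w, w') \<in> acc F)"

definition least_world :: "('w, 'z) frame_scheme \<Rightarrow> 'w" where
  "least_world F = (THE w. is_least_world F w)"

definition up_closed :: "('w, 'z) frame_scheme \<Rightarrow> 'w set \<Rightarrow> bool" where
  "up_closed F A \<longleftrightarrow> A \<subseteq> worlds F \<and> (\<forall>w \<in> A. up F w \<subseteq> A)"

definition filter_on_props :: "('w, 'z) frame_scheme \<Rightarrow> 'w set set \<Rightarrow> bool" where
  "filter_on_props F U \<longleftrightarrow>
     U \<subseteq> props F \<and> U \<noteq> {} \<and>
     (\<forall>A \<in> U. \<forall>B \<in> U. A \<inter> B \<in> U) \<and>
     (\<forall>A \<in> U. \<forall>B \<in> props F. A \<subseteq> B \<longrightarrow> B \<in> U)"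

definition imp_set :: "('w, 'z) frame_scheme \<Rightarrow> 'w set \<Rightarrow> 'w set \<Rightarrow> 'w set" where
  "imp_set F A B = {w \<in> worlds F. \<forall>w' \<in> up F w. w' \<in> A \<longrightarrow> w' \<in> B}"

definition K_set :: "('w, 'z) frame_scheme \<Rightarrow> 'w set \<Rightarrow> 'w set" where
  "K_set F A = {w \<in> worlds F. A \<in> ev F w}"

locale IEL_frame =
  fixes F :: "('w, 'z) frame_scheme"
  assumes worlds_nonempty: "worlds F \<noteq> {}"
    and acc_order: "partial_order_on (worlds F) (acc F)"
    and least_exists: "\<exists>w. is_least_world F w"
    and chain_bound: "C \<in> Chains (acc F) \<Longrightarrow> \<exists>u \<in> worlds F. \<forall>w \<in> C. (w, u) \<in> acc F"
    and props_up_closed: "A \<in> props F \<Longrightarrow> up_closed F A"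
    and ev_filter: "w \<in> worlds F \<Longrightarrow> filter_on_props F (ev F w)"
    and ev_mono: "\<lbrakk>w \<in> worlds F; w' \<in> worlds F; (w, w') \<in> acc F\<rbrakk> \<Longrightarrow> ev F w \<subseteq> ev F w'"
    and empty_prop: "{} \<in> props F"
    and worlds_prop: "worlds F \<in> props F"
    and int_prop: "\<lbrakk>A \<in> props F; B \<in> props F\<rbrakk> \<Longrightarrow> A \<inter> B \<in> props F"
    and un_prop: "\<lbrakk>A \<in> props F; B \<in> props F\<rbrakk> \<Longrightarrow> A \<union> B \<in> props F"
    and imp_prop: "\<lbrakk>A \<in> props F; B \<in> props F\<rbrakk> \<Longrightarrow> imp_set F A B \<in> props F"
    and K_prop: "A \<in> props F \<Longrightarrow> K_set F A \<in> props F"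
    and ev_max: "\<lbrakk>w \<in> worlds F; A \<in> ev F w\<rbrakk> \<Longrightarrow> max_worlds F \<inter> up F w \<subseteq> A"
    and IntCo: "\<lbrakk>w \<in> worlds F; A \<in> props F; w \<in> A\<rbrakk> \<Longrightarrow> A \<in> ev F w"

locale relational_IEL_model = IEL_frame F
  for F :: "('w, 'z) frame_scheme" and g :: "'v \<Rightarrow> 'w set" +
  assumes val_prop: "g x \<in> props F"

primrec rsat :: "('w, 'z) frame_scheme \<Rightarrow> ('v \<Rightarrow> 'w set) \<Rightarrow> 'w \<Rightarrow> 'v fm \<Rightarrow> bool" where
  "rsat F g w (Var x) \<longleftrightarrow> w \<in> g x"
| "rsat F g w Falsum \<longleftrightarrow> False"
| "rsat F g w (Con \<phi> \<psi>) \<longleftrightarrow> rsat F g w \<phi> \<and> rsat F g w \<psi>"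
| "rsat F g w (Dis \<phi> \<psi>) \<longleftrightarrow> rsat F g w \<phi> \<or> rsat F g w \<psi>"
| "rsat F g w (Imp \<phi> \<psi>) \<longleftrightarrow> (\<forall>w' \<in> up F w. rsat F g w' \<phi> \<longrightarrow> rsat F g w' \<psi>)"
| "rsat F g w (Know \<phi>) \<longleftrightarrow> {w' \<in> worlds F. rsat F g w' \<phi>} \<in> ev F w"

definition rmodel_sat :: "('w, 'z) frame_scheme \<Rightarrow> ('v \<Rightarrow> 'w set) \<Rightarrow> 'v fm \<Rightarrow> bool" where
  "rmodel_sat F g \<phi> \<longleftrightarrow> rsat F g (least_world F) \<phi>"

end

(* The worlds are the prime filters of the algebra, ordered by inclusion, and the propositions
   are the Stone sets [a] = {w. a \<in> w}, with evidence E(w) = {[a]. K a \<in> w}. By the prime filter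
   theorem a \<mapsto> [a] is an embedding that turns the algebraic operations into those of the frame, so
   w satisfies \<phi> iff the value of \<phi> lies in w. The disjunction property makes {top} prime, hence the
   least world, and membership in {top} is algebraic satisfaction. The axiom K a \<le> \<not>\<not>a
   gives the condition on maximal worlds, as these filters contain a or \<not>a. *)

theory Submission
  imports Defs
begin

section \<open>Order and filters in Heyting algebras\<close>

context heyting_algebra
begin

lemma hle_refl: "a \<in> univ M \<Longrightarrow> hle M a a"
  unfolding hle_def by (metis and_absorb and_closed or_absorb)

lemma hle_antisym: "\<lbrakk>hle M a b; hle M b a; a \<in> univ M; b \<in> univ M\<rbrakk> \<Longrightarrow> a = b"
  unfolding hle_def by (metis and_comm)

lemma hle_trans:
  "\<lbrakk>hle M a b; hle M b c; a \<in> univ M; b \<in> univ M; c \<in> univ M\<rbrakk> \<Longrightarrow> hle M a c"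
  unfolding hle_def by (metis and_assoc)

lemma and_le1: "\<lbrakk>a \<in> univ M; b \<in> univ M\<rbrakk> \<Longrightarrow> hle M (fAnd M a b) a"
  unfolding hle_def by (metis and_assoc and_comm and_closed hle_refl[unfolded hle_def])

lemma and_le2: "\<lbrakk>a \<in> univ M; b \<in> univ M\<rbrakk> \<Longrightarrow> hle M (fAnd M a b) b"
  by (metis and_comm and_le1)

lemma le_and:
  "\<lbrakk>hle M c a; hle M c b; a \<in> univ M; b \<in> univ M; c \<in> univ M\<rbrakk> \<Longrightarrow> hle M c (fAnd M a b)"
  unfolding hle_def by (metis and_assoc)

lemma le_or1: "\<lbrakk>a \<in> univ M; b \<in> univ M\<rbrakk> \<Longrightarrow> hle M a (fOr M a b)"
  unfolding hle_def by (rule and_absorb)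

lemma le_or2: "\<lbrakk>a \<in> univ M; b \<in> univ M\<rbrakk> \<Longrightarrow> hle M b (fOr M a b)"
  by (metis or_comm le_or1)

text \<open>The order is defined through meets; the absorption laws give the dual description
  through joins, which makes \<open>or_le\<close> an equational computation.\<close>

lemma hle_iff_or: "\<lbrakk>a \<in> univ M; b \<in> univ M\<rbrakk> \<Longrightarrow> hle M a b \<longleftrightarrow> fOr M a b = b"
  unfolding hle_def by (metis and_absorb and_comm or_absorb or_comm)

lemma or_le:
  "\<lbrakk>hle M a c; hle M b c; a \<in> univ M; b \<in> univ M; c \<in> univ M\<rbrakk> \<Longrightarrow> hle M (fOr M a b) c"
  by (simp add: hle_iff_or or_assoc or_closed)

lemma imp_mp: "\<lbrakk>a \<in> univ M; b \<in> univ M\<rbrakk> \<Longrightarrow> hle M (fAnd M (fImp M a b) a) b"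
  by (metis residuation hle_refl imp_closed)

lemma le_imp: "\<lbrakk>a \<in> univ M; b \<in> univ M\<rbrakk> \<Longrightarrow> hle M b (fImp M a b)"
  by (simp add: residuation and_le1)

lemma top_le: "\<lbrakk>hle M (fTop M) a; a \<in> univ M\<rbrakk> \<Longrightarrow> a = fTop M"
  by (metis hle_antisym top_greatest top_closed)

lemma imp_eq_top: "\<lbrakk>hle M a b; a \<in> univ M; b \<in> univ M\<rbrakk> \<Longrightarrow> fImp M a b = fTop M"
  by (metis top_le residuation top_closed imp_closed and_le2 and_closed hle_trans)

section \<open>Filters and the prime filter theorem\<close>

definition lfilter :: "'m set \<Rightarrow> bool" where
  "lfilter F \<longleftrightarrow> F \<subseteq> univ M \<and> fTop M \<in> F \<and> (\<forall>a \<in> F. \<forall>b \<in> F. fAnd M a b \<in> F) \<and>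
     (\<forall>a \<in> F. \<forall>b \<in> univ M. hle M a b \<longrightarrow> b \<in> F)"

text \<open>Properness is demanded here and not in \<open>lfilter\<close>, so that generated filters
  need no consistency check.\<close>

definition prime_filter :: "'m set \<Rightarrow> bool" where
  "prime_filter F \<longleftrightarrow> lfilter F \<and> fBot M \<notin> F \<and>
     (\<forall>a \<in> univ M. \<forall>b \<in> univ M. fOr M a b \<in> F \<longrightarrow> a \<in> F \<or> b \<in> F)"

lemma lfilter_subset: "lfilter F \<Longrightarrow> a \<in> F \<Longrightarrow> a \<in> univ M"
  by (auto simp: lfilter_def)

lemma lfilter_top: "lfilter F \<Longrightarrow> fTop M \<in> F"
  by (simp add: lfilter_def)

lemma lfilter_up: "\<lbrakk>lfilter F; a \<in> F; b \<in> univ M; hle M a b\<rbrakk> \<Longrightarrow> b \<in> F"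
  by (auto simp: lfilter_def)

lemma lfilter_and:
  "\<lbrakk>lfilter F; a \<in> univ M; b \<in> univ M\<rbrakk> \<Longrightarrow> fAnd M a b \<in> F \<longleftrightarrow> a \<in> F \<and> b \<in> F"
  by (metis lfilter_def and_le1 and_le2)

lemma lfilter_mp:
  "\<lbrakk>lfilter F; fImp M a b \<in> F; a \<in> F; b \<in> univ M\<rbrakk> \<Longrightarrow> b \<in> F"
  by (metis lfilter_and lfilter_up lfilter_subset imp_mp)

lemma lfilter_principal: "a \<in> univ M \<Longrightarrow> lfilter {b \<in> univ M. hle M a b}"
  unfolding lfilter_def
  by (auto intro: le_and and_closed top_closed top_greatest elim: hle_trans)

text \<open>This is the filter generated by \<open>F\<close> and \<open>a\<close>: by residuation,
  \<open>b\<close> lies above \<open>fAnd M f a\<close> for some \<open>f\<close> in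
  \<open>F\<close> iff \<open>fImp M a b\<close> is in \<open>F\<close>. The residual replaces the
  existential quantifier.\<close>

lemma lfilter_adjoin:
  assumes F: "lfilter F" and a: "a \<in> univ M"
  shows "lfilter {b \<in> univ M. fImp M a b \<in> F}" (is "lfilter ?G")
    and "F \<subseteq> {b \<in> univ M. fImp M a b \<in> F}"
    and "a \<in> {b \<in> univ M. fImp M a b \<in> F}"
proof -
  have key: "fImp M a c \<in> F"
    if "b \<in> univ M" "c \<in> univ M" "fImp M a b \<in> F" "hle M (fAnd M (fImp M a b) a) c" for b c
    using that by (metis F a imp_closed lfilter_up residuation)
  show sub: "F \<subseteq> ?G"
    using F a by (auto intro: lfilter_subset lfilter_up imp_closed le_imp)
  show "a \<in> ?G"
    using a F by (simp add: imp_eq_top hle_refl lfilter_top)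
  have "fAnd M b c \<in> ?G" if "b \<in> ?G" "c \<in> ?G" for b c
  proof -
    have b: "b \<in> univ M" "fImp M a b \<in> F" and c: "c \<in> univ M" "fImp M a c \<in> F"
      using that by auto
    \<comment> \<open>The meet of both residuals stays in \<open>F\<close>, and together with
      \<open>a\<close> it lies below both \<open>b\<close> and \<open>c\<close>.\<close>
    let ?p = "fAnd M (fImp M a b) (fImp M a c)"
    have p: "?p \<in> univ M" "fAnd M ?p a \<in> univ M" and pF: "?p \<in> F"
      using a b c F by (simp_all add: and_closed imp_closed lfilter_and)
    have "hle M (fAnd M ?p a) b" "hle M (fAnd M ?p a) c"
      using a b c p by (metis residuation and_le1 imp_closed, metis residuation and_le2 imp_closed)
    then have "hle M ?p (fImp M a (fAnd M b c))"
      using a b c p by (simp add: residuation le_and and_closed)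
    then show ?thesis
      using pF a b c F by (auto intro: lfilter_up and_closed imp_closed)
  qed
  moreover have "c \<in> ?G" if "b \<in> ?G" "c \<in> univ M" "hle M b c" for b c
  proof -
    have b: "b \<in> univ M" "fImp M a b \<in> F" using that by auto
    have "hle M (fAnd M (fImp M a b) a) c"
      using a b that by (meson hle_trans imp_mp and_closed imp_closed)
    then show ?thesis using key b that by blast
  qed
  ultimately show "lfilter ?G"
    using sub F unfolding lfilter_def by blast
qed

text \<open>Any two elements of the union already lie in one member of the chain. A nonempty
  \<open>C\<close> supplies the top element.\<close>

lemma lfilter_Union_chain:
  assumes C: "\<And>F. F \<in> C \<Longrightarrow> lfilter F" and "C \<noteq> {}"
    and chain: "\<And>F G. \<lbrakk>F \<in> C; G \<in> C\<rbrakk> \<Longrightarrow> F \<subseteq> G \<or> G \<subseteq> F"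
  shows "lfilter (\<Union>C)"
proof -
  have "fAnd M a b \<in> \<Union>C" if ab: "a \<in> F" "b \<in> G" "F \<in> C" "G \<in> C" for a b F G
  proof -
    obtain H where "H \<in> C" "a \<in> H" "b \<in> H"
      using ab chain[of F G] by blast
    then show ?thesis
      using C unfolding lfilter_def by blast
  qed
  moreover have "b \<in> \<Union>C" if "a \<in> \<Union>C" "b \<in> univ M" "hle M a b" for a b
    using that C lfilter_up by blast
  moreover have "\<Union>C \<subseteq> univ M" "fTop M \<in> \<Union>C"
    using C \<open>C \<noteq> {}\<close> lfilter_subset lfilter_top by auto
  ultimately show ?thesis
    unfolding lfilter_def by (meson UnionE)
qed

text \<open>Zorn's lemma yields a filter maximal among those that extend \<open>F\<close> and avoid
  \<open>b\<close>; maximality makes it prime.\<close>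

theorem prime_filter_extension:
  assumes F: "lfilter F" and b: "b \<in> univ M" "b \<notin> F"
  obtains G where "prime_filter G" "F \<subseteq> G" "b \<notin> G"
proof -
  let ?A = "{G. lfilter G \<and> F \<subseteq> G \<and> b \<notin> G}"
  have "\<exists>G \<in> ?A. \<forall>X \<in> ?A. G \<subseteq> X \<longrightarrow> X = G"
  proof (rule subset_Zorn_nonempty)
    show "?A \<noteq> {}" using F b by blast
    show "\<Union>C \<in> ?A" if "C \<noteq> {}" "subset.chain ?A C" for C
    proof -
      have "lfilter (\<Union>C)"
        using that by (intro lfilter_Union_chain) (auto simp: subset_chain_def)
      then show ?thesis
        using that by (auto simp: subset_chain_def)
    qed
  qed
  then obtain G where G: "lfilter G" "F \<subseteq> G" "b \<notin> G"
    and max: "\<And>X. \<lbrakk>lfilter X; G \<subseteq> X; b \<notin> X\<rbrakk> \<Longrightarrow> X = G"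
    by (smt (verit) mem_Collect_eq order_trans)
  \<comment> \<open>Adjoining \<open>c\<close> to \<open>G\<close> gives a strictly larger filter,
    which by maximality must contain \<open>b\<close>.\<close>
  have imp_b: "fImp M c b \<in> G" if "c \<in> univ M" "c \<notin> G" for c
    using lfilter_adjoin[OF G(1) that(1)] max that(2) b(1) by blast
  have "c \<in> G \<or> d \<in> G" if cd: "c \<in> univ M" "d \<in> univ M" "fOr M c d \<in> G" for c d
  proof (rule ccontr)
    assume "\<not> (c \<in> G \<or> d \<in> G)"
    \<comment> \<open>The residual \<open>p \<rightarrow> b\<close> bounds \<open>c\<close> and \<open>d\<close>, hence \<open>c \<or> d\<close>; no distributivity is needed.\<close>
    define p where "p = fAnd M (fImp M c b) (fImp M d b)"
    have p: "p \<in> univ M" "p \<in> G"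
      using \<open>\<not> (c \<in> G \<or> d \<in> G)\<close> cd b G imp_b
      by (simp_all add: p_def lfilter_and and_closed imp_closed)
    have "hle M (fAnd M p c) b" "hle M (fAnd M p d) b"
      using cd b p(1) unfolding p_def
      by (metis residuation and_le1 imp_closed, metis residuation and_le2 imp_closed)
    then have "hle M c (fImp M p b)" "hle M d (fImp M p b)"
      using cd b p by (simp_all add: residuation and_comm)
    then have "hle M (fOr M c d) (fImp M p b)"
      using cd b p by (intro or_le imp_closed)
    then have "fImp M p b \<in> G"
      using cd b p G by (meson lfilter_up imp_closed)
    then show False
      using lfilter_mp G p b by blast
  qed
  moreover have "fBot M \<notin> G"
    using G b bot_least lfilter_up by blast
  ultimately show thesis
    using that G unfolding prime_filter_def by blast
qed

section \<open>Stone sets\<close>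

definition stone :: "'m \<Rightarrow> 'm set set" where
  "stone a = {w. prime_filter w \<and> a \<in> w}"

lemma stone_iff: "w \<in> stone a \<longleftrightarrow> prime_filter w \<and> a \<in> w"
  by (simp add: stone_def)

text \<open>If \<open>a\<close> is not below \<open>b\<close>, the principal filter of
  \<open>a\<close> avoids \<open>b\<close>, and a prime extension of it separates the two Stone
  sets.\<close>

lemma stone_subset_iff:
  assumes "a \<in> univ M" "b \<in> univ M"
  shows "stone a \<subseteq> stone b \<longleftrightarrow> hle M a b"
proof
  assume "stone a \<subseteq> stone b"
  show "hle M a b"
  proof (rule ccontr)
    assume "\<not> hle M a b"
    then obtain G where "prime_filter G" "{b \<in> univ M. hle M a b} \<subseteq> G" "b \<notin> G"
      using prime_filter_extension[OF lfilter_principal] assms by blast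
    moreover have "a \<in> {b \<in> univ M. hle M a b}"
      using assms hle_refl by auto
    ultimately show False
      using \<open>stone a \<subseteq> stone b\<close> by (auto simp: stone_def)
  qed
next
  assume "hle M a b"
  then show "stone a \<subseteq> stone b"
    using assms by (auto simp: stone_def prime_filter_def intro: lfilter_up)
qed

lemma stone_inj: "\<lbrakk>stone a = stone b; a \<in> univ M; b \<in> univ M\<rbrakk> \<Longrightarrow> a = b"
  by (metis hle_antisym stone_subset_iff subset_refl)

lemma stone_bot: "stone (fBot M) = {}"
  by (auto simp: stone_def prime_filter_def)

lemma stone_top: "stone (fTop M) = Collect prime_filter"
  unfolding stone_def prime_filter_def using lfilter_top by blast

lemma stone_and:
  "\<lbrakk>a \<in> univ M; b \<in> univ M\<rbrakk> \<Longrightarrow> stone (fAnd M a b) = stone a \<inter> stone b"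
  by (auto simp: stone_def prime_filter_def lfilter_and)

lemma stone_or:
  "\<lbrakk>a \<in> univ M; b \<in> univ M\<rbrakk> \<Longrightarrow> stone (fOr M a b) = stone a \<union> stone b"
  unfolding stone_def prime_filter_def
  using lfilter_up[OF _ _ or_closed le_or1] lfilter_up[OF _ _ or_closed le_or2] by blast

text \<open>If \<open>fImp M a b\<close> is not in \<open>w\<close>, the filter generated by
  \<open>w\<close> and \<open>a\<close> avoids \<open>b\<close>; a prime extension of it is the
  counterexample \<open>u\<close>.\<close>

lemma prime_filter_imp_iff:
  assumes w: "prime_filter w" and ab: "a \<in> univ M" "b \<in> univ M"
  shows "fImp M a b \<in> w \<longleftrightarrow> (\<forall>u. prime_filter u \<and> w \<subseteq> u \<and> a \<in> u \<longrightarrow> b \<in> u)"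
proof
  assume "fImp M a b \<in> w"
  then show "\<forall>u. prime_filter u \<and> w \<subseteq> u \<and> a \<in> u \<longrightarrow> b \<in> u"
    using ab by (auto simp: prime_filter_def intro: lfilter_mp)
next
  assume all: "\<forall>u. prime_filter u \<and> w \<subseteq> u \<and> a \<in> u \<longrightarrow> b \<in> u"
  have lw: "lfilter w" using w by (simp add: prime_filter_def)
  show "fImp M a b \<in> w"
  proof (rule ccontr)
    assume "fImp M a b \<notin> w"
    then have "b \<notin> {b \<in> univ M. fImp M a b \<in> w}" by simp
    then obtain u where "prime_filter u" "{b \<in> univ M. fImp M a b \<in> w} \<subseteq> u" "b \<notin> u"
      using prime_filter_extension[OF lfilter_adjoin(1)[OF lw ab(1)] ab(2)] by blast
    then show False
      using all lfilter_adjoin(2,3)[OF lw ab(1)] by blast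
  qed
qed

text \<open>Properness and primeness concern membership of single elements, so they pass from the
  members to the union. These unions bound the chains of worlds.\<close>

lemma prime_filter_Union_chain:
  assumes "\<And>F. F \<in> C \<Longrightarrow> prime_filter F" "C \<noteq> {}"
    and "\<And>F G. \<lbrakk>F \<in> C; G \<in> C\<rbrakk> \<Longrightarrow> F \<subseteq> G \<or> G \<subseteq> F"
  shows "prime_filter (\<Union>C)"
proof -
  have "lfilter (\<Union>C)"
    using assms by (intro lfilter_Union_chain) (auto simp: prime_filter_def)
  then show ?thesis
    using assms(1) unfolding prime_filter_def by blast
qed

text \<open>The only prime extension of \<open>u\<close> is \<open>u\<close> itself, so a missing
  \<open>a\<close> would put \<open>fNot M a\<close> into \<open>u\<close>; with its negation also
  there, \<open>fBot M\<close> would follow.\<close>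

lemma prime_filter_maximal:
  assumes u: "prime_filter u" and max: "\<And>v. \<lbrakk>prime_filter v; u \<subseteq> v\<rbrakk> \<Longrightarrow> v = u"
    and a: "a \<in> univ M" and nn: "fNot M (fNot M a) \<in> u"
  shows "a \<in> u"
proof (rule ccontr)
  assume "a \<notin> u"
  then have "fNot M a \<in> u"
    unfolding fNot_def using u a bot_closed max by (auto simp: prime_filter_imp_iff)
  then have "fBot M \<in> u"
    using nn u lfilter_mp bot_closed unfolding fNot_def prime_filter_def by blast
  then show False using u by (simp add: prime_filter_def)
qed

end

section \<open>The frame of prime filters\<close>

context algebraic_IELm_model
begin

text \<open>The residual of \<open>a \<le> b\<close> is the top element, which \<open>fK M\<close>
  fixes because it belongs to \<open>BEL M\<close>; \<open>K_imp\<close> then distributes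
  \<open>fK M\<close> over the implication.\<close>

lemma K_mono: "\<lbrakk>hle M a b; a \<in> univ M; b \<in> univ M\<rbrakk> \<Longrightarrow> hle M (fK M a) (fK M b)"
proof -
  assume ab: "hle M a b" "a \<in> univ M" "b \<in> univ M"
  have "fK M (fImp M a b) = fTop M"
    using ab K_top_iff top_BEL imp_eq_top top_closed by metis
  then have "fImp M (fK M a) (fK M b) = fTop M"
    using K_imp ab top_le imp_closed K_closed by metis
  then have "hle M (fAnd M (fTop M) (fK M a)) (fK M b)"
    using imp_mp ab K_closed by metis
  then show ?thesis
    using ab by (metis K_closed and_comm hle_def top_closed top_greatest)
qed

text \<open>The usual modal argument: curry to \<open>a \<le> (b \<rightarrow> a \<and> b)\<close>,
  apply \<open>K_mono\<close> and \<open>K_imp\<close>, and uncurry. It makes evidence closed under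
  intersection.\<close>

lemma K_and:
  assumes a: "a \<in> univ M" and b: "b \<in> univ M"
  shows "hle M (fAnd M (fK M a) (fK M b)) (fK M (fAnd M a b))"
proof -
  have "hle M a (fImp M b (fAnd M a b))"
    using a b by (simp add: residuation and_closed hle_refl)
  then have "hle M (fK M a) (fK M (fImp M b (fAnd M a b)))"
    using a b by (simp add: K_mono imp_closed and_closed)
  then have "hle M (fK M a) (fImp M (fK M b) (fK M (fAnd M a b)))"
    using a b K_imp[of b "fAnd M a b"] by (meson hle_trans imp_closed and_closed K_closed)
  then show ?thesis
    using a b by (simp add: residuation K_closed and_closed)
qed

text \<open>Primeness of this filter is the disjunction property, and its properness is
  nontriviality.\<close>

lemma prime_filter_top:
  assumes "fBot M \<noteq> fTop M"
  shows "prime_filter {fTop M}"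
  using assms disjunction top_closed hle_refl top_le
  by (auto simp: prime_filter_def lfilter_def hle_def)

definition stone_frame :: "'m set frame" where
  "stone_frame = \<lparr>worlds = Collect prime_filter,
     acc = {(w, u). prime_filter w \<and> prime_filter u \<and> w \<subseteq> u},
     props = stone ` univ M,
     ev = \<lambda>w. {stone a | a. a \<in> univ M \<and> fK M a \<in> w}\<rparr>"

lemma stone_frame_simps [simp]:
  "worlds stone_frame = Collect prime_filter"
  "(w, u) \<in> acc stone_frame \<longleftrightarrow> prime_filter w \<and> prime_filter u \<and> w \<subseteq> u"
  "props stone_frame = stone ` univ M"
  by (auto simp: stone_frame_def)

text \<open>Evidence is defined through some representative of a Stone set; injectivity of
  \<open>stone\<close> makes the choice immaterial.\<close>

lemma stone_in_ev [simp]: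
  assumes "a \<in> univ M"
  shows "stone a \<in> ev stone_frame w \<longleftrightarrow> fK M a \<in> w"
  using assms stone_inj by (auto simp: stone_frame_def)

lemma evE:
  assumes "A \<in> ev stone_frame w"
  obtains a where "a \<in> univ M" "A = stone a" "fK M a \<in> w"
  using assms by (auto simp: stone_frame_def)

lemma up_stone_frame: "prime_filter w \<Longrightarrow> up stone_frame w = {u. prime_filter u \<and> w \<subseteq> u}"
  by (auto simp: up_def)

lemma imp_set_stone:
  "\<lbrakk>a \<in> univ M; b \<in> univ M\<rbrakk> \<Longrightarrow> imp_set stone_frame (stone a) (stone b) = stone (fImp M a b)"
  by (auto simp: imp_set_def up_stone_frame stone_iff prime_filter_imp_iff)

lemma K_set_stone: "a \<in> univ M \<Longrightarrow> K_set stone_frame (stone a) = stone (fK M a)"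
  by (auto simp: K_set_def stone_iff)

text \<open>Nonemptiness comes from \<open>fK M (fTop M) = fTop M\<close>, intersections from
  \<open>K_and\<close>, and upward closure from \<open>K_mono\<close>.\<close>

lemma filter_on_props_ev:
  assumes w: "prime_filter w"
  shows "filter_on_props stone_frame (ev stone_frame w)"
proof -
  have lw: "lfilter w" using w by (simp add: prime_filter_def)
  have "fK M (fTop M) \<in> w"
    using lw K_top_iff top_BEL top_closed lfilter_top by metis
  then have "stone (fTop M) \<in> ev stone_frame w"
    by (simp add: top_closed)
  moreover have "A \<inter> B \<in> ev stone_frame w"
    if AB: "A \<in> ev stone_frame w" "B \<in> ev stone_frame w" for A B
  proof -
    obtain a b where a: "a \<in> univ M" "A = stone a" "fK M a \<in> w"
      and b: "b \<in> univ M" "B = stone b" "fK M b \<in> w"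
      using AB by (metis evE)
    have "fAnd M (fK M a) (fK M b) \<in> w"
      using a b lw by (simp add: lfilter_and K_closed)
    then have "fK M (fAnd M a b) \<in> w"
      using a b lw by (meson lfilter_up K_and K_closed and_closed)
    then show ?thesis
      using a b by (simp add: and_closed flip: stone_and)
  qed
  moreover have "B \<in> ev stone_frame w"
    if AB: "A \<in> ev stone_frame w" "B \<in> props stone_frame" "A \<subseteq> B" for A B
  proof -
    obtain a where a: "a \<in> univ M" "A = stone a" "fK M a \<in> w"
      using AB(1) by (rule evE)
    obtain b where b: "b \<in> univ M" "B = stone b"
      using AB(2) by auto
    have "hle M (fK M a) (fK M b)"
      using AB(3) a b by (simp add: stone_subset_iff K_mono)
    then have "fK M b \<in> w"
      using a b lw by (meson lfilter_up K_closed)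
    then show ?thesis using b by simp
  qed
  moreover have "ev stone_frame w \<subseteq> props stone_frame"
    by (auto elim: evE)
  ultimately show ?thesis
    unfolding filter_on_props_def by blast
qed

section \<open>Truth lemma and least world\<close>

lemma aeval_closed: "(\<And>x. \<gamma> x \<in> univ M) \<Longrightarrow> aeval M \<gamma> \<phi> \<in> univ M"
  by (induction \<phi>) (auto intro: bot_closed and_closed or_closed imp_closed K_closed)

lemma rsat_stone_frame:
  fixes \<gamma> :: "'v \<Rightarrow> 'm"
  assumes \<gamma>: "\<And>x. \<gamma> x \<in> univ M" and "prime_filter w"
  shows "rsat stone_frame (\<lambda>x. stone (\<gamma> x)) w \<phi> \<longleftrightarrow> aeval M \<gamma> \<phi> \<in> w"
  using assms(2)
\<comment> \<open>The world stays arbitrary: \<open>Imp\<close> passes to larger filters, and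
  \<open>Know\<close> needs the truth set over all worlds.\<close>
proof (induction \<phi> arbitrary: w)
  case (Var x)
  then show ?case by (simp add: stone_iff)
next
  case Falsum
  then show ?case by (simp add: prime_filter_def)
next
  case (Con \<phi> \<psi>)
  then show ?case
    by (simp add: prime_filter_def lfilter_and aeval_closed[OF \<gamma>])
next
  case (Dis \<phi> \<psi>)
  then show ?case
    using stone_or[of "aeval M \<gamma> \<phi>" "aeval M \<gamma> \<psi>"] aeval_closed[of \<gamma>, OF \<gamma>]
    by (auto simp: stone_def)
next
  case (Imp \<phi> \<psi>)
  then show ?case
    by (auto simp: up_stone_frame prime_filter_imp_iff aeval_closed[OF \<gamma>])
next
  case (Know \<phi>)
  \<comment> \<open>The induction hypothesis at every world turns the truth set into a Stone set, so
    that \<open>stone_in_ev\<close> applies.\<close>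
  have "{u \<in> worlds stone_frame. rsat stone_frame (\<lambda>x. stone (\<gamma> x)) u \<phi>} = stone (aeval M \<gamma> \<phi>)"
    using Know.IH by (auto simp: stone_iff)
  then show ?case
    by (simp add: aeval_closed[OF \<gamma>])
qed

lemma is_least_world_top:
  assumes "fBot M \<noteq> fTop M"
  shows "is_least_world stone_frame {fTop M}"
  using prime_filter_top[OF assms]
  by (auto simp: is_least_world_def prime_filter_def lfilter_top)

lemma least_world_stone_frame:
  assumes "fBot M \<noteq> fTop M"
  shows "least_world stone_frame = {fTop M}"
  unfolding least_world_def
proof (rule the_equality)
  show top: "is_least_world stone_frame {fTop M}"
    using assms by (rule is_least_world_top)
  show "w = {fTop M}" if "is_least_world stone_frame w" for w
    using that top by (auto 0 3 simp: is_least_world_def)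
qed

end

section \<open>Verification of the frame conditions\<close>

lemma (in algebraic_IEL_model) IEL_frame_stone_frame:
  assumes nontriv: "fBot M \<noteq> fTop M"
  shows "IEL_frame stone_frame"
proof
  show "worlds stone_frame \<noteq> {}"
    using prime_filter_top[OF nontriv] by auto
  show "partial_order_on (worlds stone_frame) (acc stone_frame)"
    by (auto simp: partial_order_on_def preorder_on_def refl_on_def trans_def antisym_def)
  show "\<exists>w. is_least_world stone_frame w"
    using is_least_world_top[OF nontriv] by blast
next
  fix C
  assume "C \<in> Chains (acc stone_frame)"
  then have C: "\<And>F. F \<in> C \<Longrightarrow> prime_filter F"
    "\<And>F G. \<lbrakk>F \<in> C; G \<in> C\<rbrakk> \<Longrightarrow> F \<subseteq> G \<or> G \<subseteq> F"
    by (auto simp: Chains_def)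
  show "\<exists>u \<in> worlds stone_frame. \<forall>w \<in> C. (w, u) \<in> acc stone_frame"
  proof (cases "C = {}")
    \<comment> \<open>The empty union lacks the top element and is no filter, so the least world
      serves as the bound.\<close>
    case True
    then show ?thesis using prime_filter_top[OF nontriv] by auto
  next
    case False
    then have "prime_filter (\<Union>C)"
      using C by (intro prime_filter_Union_chain)
    then show ?thesis using C by (intro bexI[of _ "\<Union>C"]) auto
  qed
next
  fix A
  assume A: "A \<in> props stone_frame"
  then show "up_closed stone_frame A"
    by (auto simp: up_closed_def up_def stone_iff)
  show "K_set stone_frame A \<in> props stone_frame"
    using A by (auto simp: K_set_stone K_closed)
  fix B
  assume B: "B \<in> props stone_frame"
  show "A \<inter> B \<in> props stone_frame"
    using A B by (auto simp: and_closed simp flip: stone_and)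
  show "A \<union> B \<in> props stone_frame"
    using A B by (auto simp: or_closed simp flip: stone_or)
  show "imp_set stone_frame A B \<in> props stone_frame"
    using A B by (auto simp: imp_set_stone imp_closed)
next
  show "{} \<in> props stone_frame"
    using bot_closed stone_bot by auto
  show "worlds stone_frame \<in> props stone_frame"
    using top_closed stone_top by auto
next
  fix w
  assume "w \<in> worlds stone_frame"
  then have w: "prime_filter w" and lw: "lfilter w" by (simp_all add: prime_filter_def)
  show "filter_on_props stone_frame (ev stone_frame w)"
    using w by (rule filter_on_props_ev)
  show "ev stone_frame w \<subseteq> ev stone_frame u" if "(w, u) \<in> acc stone_frame" for u
    using that by (auto elim!: evE)
  show "max_worlds stone_frame \<inter> up stone_frame w \<subseteq> A" if "A \<in> ev stone_frame w" for A
  proof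
    fix u
    assume u: "u \<in> max_worlds stone_frame \<inter> up stone_frame w"
    obtain a where a: "a \<in> univ M" "A = stone a" "fK M a \<in> w"
      using evE \<open>A \<in> ev stone_frame w\<close> by metis
    have pu: "prime_filter u" and wu: "w \<subseteq> u"
      and max: "\<And>v. \<lbrakk>prime_filter v; u \<subseteq> v\<rbrakk> \<Longrightarrow> v = u"
      using u w by (auto simp: max_worlds_def up_stone_frame)
    \<comment> \<open>Here \<open>K_reflection\<close> enters: knowledge of \<open>a\<close> at
      \<open>w\<close> gives its double negation, which a maximal \<open>u\<close> above
      \<open>w\<close> turns into \<open>a\<close>.\<close>
    have "fNot M (fNot M a) \<in> w"
      using lfilter_up[OF lw a(3) _ K_reflection] a(1) by (simp add: fNot_def imp_closed bot_closed)
    then have "a \<in> u"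
      using prime_filter_maximal[OF pu max a(1)] wu by blast
    then show "u \<in> A" using a pu by (simp add: stone_iff)
  qed
  \<comment> \<open>For \<open>A = stone a\<close>, the inequality \<open>a \<le> fK M a\<close>
    puts \<open>fK M a\<close> into \<open>w\<close>.\<close>
  show "A \<in> ev stone_frame w" if "A \<in> props stone_frame" "w \<in> A" for A
    using that lfilter_up[OF lw _ K_closed K_intro] by (auto simp: stone_iff)
qed

text \<open>Nontriviality matters: in the one-element algebra \<open>Falsum\<close> takes the value
  \<open>fTop M\<close>, while no relational model satisfies it.\<close>

theorem theorem5p7:
  fixes M :: "'m epistemic_algebra" and \<gamma> :: "'v \<Rightarrow> 'm"
  assumes "infinite (UNIV :: 'v set)"
    and "algebraic_IEL_model M"
    and "fBot M \<noteq> fTop M"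
    and "\<forall>x. \<gamma> x \<in> univ M"
  shows "\<exists>(F :: 'm set frame) (g :: 'v \<Rightarrow> 'm set set).
           relational_IEL_model F g \<and>
           (\<forall>\<phi> :: 'v fm. asat M \<gamma> \<phi> \<longleftrightarrow> rmodel_sat F g \<phi>)"
proof -
  interpret algebraic_IEL_model M by fact
  have "relational_IEL_model stone_frame (\<lambda>x. stone (\<gamma> x))"
    using IEL_frame_stone_frame assms
    by (auto simp: relational_IEL_model_def relational_IEL_model_axioms_def)
  \<comment> \<open>At the least world \<open>{fTop M}\<close> the truth lemma says that the value
    of the formula is \<open>fTop M\<close>.\<close>
  moreover have "asat M \<gamma> \<phi> \<longleftrightarrow> rmodel_sat stone_frame (\<lambda>x. stone (\<gamma> x)) \<phi>" for \<phi>
    using assms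
    by (simp add: asat_def rmodel_sat_def least_world_stone_frame rsat_stone_frame
        prime_filter_top)
  ultimately show ?thesis by blast
qed

end
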